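(* Let $\{|0\rangle,|1\rangle\}$ be an orthonormal basis of $\mathcal{H}_2$, $|\varphi_1\rangle=|0\rangle$, $|\varphi_2\rangle=\frac12(|0\rangle+\sqrt3|1\rangle)$, $|\varphi_3\rangle=\frac12(|0\rangle-\sqrt3|1\rangle)$, and let $\mathcal{M}_l$ ($l=1,2,3$) be the projective qubit measurement $M_{l1}=|\varphi_l\rangle\langle\varphi_l|$, $M_{l2}=I-M_{l1}$, each occurring with prior probability $1/3$. Then the maximal success probability of minimum-error discrimination of $\mathcal{M}_1,\mathcal{M}_2,\mathcal{M}_3$ over all general (ancilla-assisted) tests equals $2/3$, whereas the maximal success probability over all simple (ancilla-free) tests equals $(2+\sqrt3)/6<2/3$.
   Context: $\mathcal{H}_2$ is the two-dimensional complex Hilbert space. A general (single-shot, ancilla-assisted) test $\mathcal{T}$ without inconclusive outcome, with conclusions $c\in\{1,2,3\}$, is a family of positive semidefinite operators $H^{(c)}_j$ on $\mathcal{H}_2$, $j=1,2$, with $\sum_{c}H^{(c)}_j=\rho$ for $j=1,2$, where $\rho\ge0$, $\mathrm{tr}[\rho]=1$ is independent of $j$. Its success probability is $p_s=\frac13\sum_{l=1}^3\sum_{j=1}^2\mathrm{tr}[H^{(l)}_jM_{lj}]$. A simple (ancilla-free) test consists of a probe state $\varrho$ on $\mathcal{H}_2$ measured by the unknown measurement, followed by classical post-processing with conditional probabilities $q(l|j)\ge0$, $\sum_lq(l|j)=1$, of conclusion $l$ given outcome $j$ (i.e. $H^{(l)}_j=q(l|j)\varrho$). Minimum-error discrimination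 means maximizing $p_s$ with no inconclusive conclusions. *)

theory Defs
  imports "HOL-Analysis.Analysis"
begin

(* Operators on the finite-dimensional Hilbert space complex ^ 'n are square matrices, acting
   by *v.  The library's inner product on complex ^ 'n is the real one, so the sesquilinear
   product (antilinear in the first argument) is introduced here. *)

definition braket :: "complex ^ 'n \<Rightarrow> complex ^ 'n \<Rightarrow> complex" where
  "braket x y = (\<Sum>i\<in>UNIV. cnj (x $ i) * y $ i)"

definition ketbra :: "complex ^ 'n \<Rightarrow> complex ^ 'n \<Rightarrow> complex ^ 'n ^ 'n" where
  "ketbra x y = (\<chi> i j. x $ i * cnj (y $ j))"

definition orthonormal_basis2 :: "complex ^ 'n \<Rightarrow> complex ^ 'n \<Rightarrow> bool" where
  "orthonormal_basis2 e f \<longleftrightarrow>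
     braket e e = 1 \<and> braket f f = 1 \<and> braket e f = 0 \<and> vec.span {e, f} = UNIV"

definition hermitian :: "complex ^ 'n ^ 'n \<Rightarrow> bool" where
  "hermitian A \<longleftrightarrow> (\<forall>i j. A $ i $ j = cnj (A $ j $ i))"

definition psd :: "complex ^ 'n ^ 'n \<Rightarrow> bool" where
  "psd A \<longleftrightarrow> hermitian A \<and> (\<forall>x. 0 \<le> Re (braket x (A *v x)))"

definition density :: "complex ^ 'n ^ 'n \<Rightarrow> bool" where
  "density \<rho> \<longleftrightarrow> psd \<rho> \<and> trace \<rho> = 1"

(* In the following, 'c indexes the conclusions of a test and 'j the outcomes of the unknown
   measurement; H c j is the operator belonging to conclusion c and outcome j. *)

definition general_test :: "('c::finite \<Rightarrow> 'j::finite \<Rightarrow> complex ^ 'n ^ 'n) \<Rightarrow> bool" where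
  "general_test H \<longleftrightarrow>
     (\<forall>c j. psd (H c j)) \<and> (\<exists>\<rho>. density \<rho> \<and> (\<forall>j. (\<Sum>c\<in>UNIV. H c j) = \<rho>))"

(* q l j is the conditional probability of conclusion l given outcome j *)
definition postprocessing :: "('c::finite \<Rightarrow> 'j::finite \<Rightarrow> real) \<Rightarrow> bool" where
  "postprocessing q \<longleftrightarrow> (\<forall>l j. 0 \<le> q l j) \<and> (\<forall>j. (\<Sum>l\<in>UNIV. q l j) = 1)"

definition simple_test :: "('c::finite \<Rightarrow> 'j::finite \<Rightarrow> complex ^ 'n ^ 'n) \<Rightarrow> bool" where
  "simple_test H \<longleftrightarrow>
     (\<exists>\<rho> q. density \<rho> \<and> postprocessing q \<and> (\<forall>l j. H l j = q l j *\<^sub>R \<rho>))"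

(* Equal priors.  The traces are real when all the operators involved are Hermitian, so that
   Re is only a coercion; see Im_trace_hermitian_mult. *)
definition success_prob ::
  "('c::finite \<Rightarrow> 'j::finite \<Rightarrow> complex ^ 'n ^ 'n) \<Rightarrow> ('c \<Rightarrow> 'j \<Rightarrow> complex ^ 'n ^ 'n) \<Rightarrow> real" where
  "success_prob M H =
     (1 / real CARD('c)) * (\<Sum>l\<in>UNIV. \<Sum>j\<in>UNIV. Re (trace (H l j ** M l j)))"

definition is_maximum :: "real set \<Rightarrow> real \<Rightarrow> bool" where
  "is_maximum S m \<longleftrightarrow> m \<in> S \<and> (\<forall>s\<in>S. s \<le> m)"

(* The numeral types 2 and 3 serve as the index sets {1, 2} and {1, 2, 3}; in them the
   numerals 2 :: 2 and 3 :: 3 coincide with 0. *)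

definition trine_ket :: "complex ^ 'n \<Rightarrow> complex ^ 'n \<Rightarrow> 3 \<Rightarrow> complex ^ 'n" where
  "trine_ket e f l =
     (if l = 1 then e
      else if l = 2 then (1 / 2 :: complex) *s (e + complex_of_real (sqrt 3) *s f)
      else (1 / 2 :: complex) *s (e - complex_of_real (sqrt 3) *s f))"

definition trine_meas :: "complex ^ 'n \<Rightarrow> complex ^ 'n \<Rightarrow> 3 \<Rightarrow> 2 \<Rightarrow> complex ^ 'n ^ 'n" where
  "trine_meas e f l j =
     (let P = ketbra (trine_ket e f l) (trine_ket e f l) in if j = 1 then P else mat 1 - P)"

lemma Im_trace_hermitian_mult:
  assumes "hermitian A" "hermitian B"
  shows "Im (trace (A ** B)) = 0"
proof -
  have "cnj (trace (A ** B)) = (\<Sum>i\<in>UNIV. \<Sum>k\<in>UNIV. cnj (A $ i $ k) * cnj (B $ k $ i))"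
    by (simp add: trace_def matrix_matrix_mult_def)
  also have "\<dots> = (\<Sum>i\<in>UNIV. \<Sum>k\<in>UNIV. A $ k $ i * B $ i $ k)"
    using assms by (intro sum.cong refl) (metis hermitian_def)
  also have "\<dots> = trace (A ** B)"
    unfolding trace_def matrix_matrix_mult_def by (subst sum.swap) simp
  finally have "Im (cnj (trace (A ** B))) = Im (trace (A ** B))" by simp
  then show ?thesis by simp
qed

end

theory Submission
  imports Defs
begin

text \<open>
  Every \<open>M l j\<close> is a rank-one projector, and so is its complement. Hence
  \<open>tr (H l j M l j) \<le> tr (H l j)\<close>, and summing over \<open>l\<close> and \<open>j\<close> bounds the success probability of a
  general test by \<open>2/3\<close>; equality holds for \<open>H l j = M l j / 3\<close>, which is a test because the
  trine projectors sum to \<open>3/2\<close> times the identity.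

  For a simple test with probe \<open>\<rho>\<close>, put \<open>p l = tr (\<rho> M l 1)\<close>. Since \<open>tr (\<rho> M l 2) = 1 - p l\<close>, the
  success probability is \<open>(1 + D) / 3\<close>, where \<open>D\<close> is an average of differences \<open>p l - p m\<close>. Such a
  difference is half the scalar product of the Bloch vector of \<open>\<rho>\<close>, which lies in the unit
  disc, with the difference of two trine vectors, which has length \<open>sqrt 3\<close>; so \<open>D \<le> sqrt 3 / 2\<close>.
  Equality is attained for the probe \<open>(e + f) / sqrt 2\<close>,
  with conclusion 2 on outcome 1 and conclusion 3 on outcome 2.
\<close>

section \<open>Sesquilinear calculus of \<open>braket\<close>, \<open>ketbra\<close> and
  \<open>trace\<close>\<close>

lemma braket_add_left: "braket (x + y) z = braket x z + braket y z"
  by (simp add: braket_def sum.distrib algebra_simps)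

lemma braket_add_right: "braket x (y + z) = braket x y + braket x z"
  by (simp add: braket_def sum.distrib algebra_simps)

lemma braket_diff_left: "braket (x - y) z = braket x z - braket y z"
  by (simp add: braket_def sum_subtractf algebra_simps)

lemma braket_diff_right: "braket x (y - z) = braket x y - braket x z"
  by (simp add: braket_def sum_subtractf algebra_simps)

lemma braket_scale_left: "braket (c *s x) y = cnj c * braket x y"
  by (simp add: braket_def sum_distrib_left algebra_simps)

lemma braket_scale_right: "braket x (c *s y) = c * braket x y"
  by (simp add: braket_def sum_distrib_left algebra_simps)

lemma braket_scaleR_right: "braket x (c *\<^sub>R y) = c *\<^sub>R braket x y"
  by (simp add: braket_def scaleR_sum_right)

lemmas braket_linear =
  braket_add_left braket_add_right braket_diff_left braket_diff_right
  braket_scale_left braket_scale_right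

lemma cnj_braket: "cnj (braket x y) = braket y x"
  by (simp add: braket_def mult.commute)

lemma ketbra_mult_vec: "ketbra x y *v z = braket y z *s x"
  by (simp add: vec_eq_iff ketbra_def braket_def matrix_vector_mult_def sum_distrib_left
      mult_ac)

lemma trace_ketbra: "trace (ketbra x y) = braket y x"
  by (simp add: trace_def ketbra_def braket_def mult.commute)

lemma trace_mult_ketbra: "trace (A ** ketbra x y) = braket y (A *v x)"
  by (simp add: trace_def ketbra_def braket_def matrix_matrix_mult_def matrix_vector_mult_def
      sum_distrib_left mult_ac)

lemma trace_scaleR: "trace (c *\<^sub>R A) = complex_of_real c * trace (A :: complex ^ 'n ^ 'n)"
  by (simp add: trace_def sum_distrib_left scaleR_conv_of_real[where 'a = complex])

lemma trace_sum: "trace (\<Sum>i\<in>I. A i) = (\<Sum>i\<in>I. trace (A i :: complex ^ 'n ^ 'n))"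
  unfolding trace_def sum_component by (rule sum.swap)

lemma scaleR_matrix_mult: "(c *\<^sub>R A) ** B = c *\<^sub>R (A ** (B :: complex ^ 'n ^ 'n))"
  by (simp add: vec_eq_iff matrix_matrix_mult_def scaleR_sum_right)

lemma scaleR_matrix_vec_mult: "(c *\<^sub>R A) *v x = c *\<^sub>R (A *v (x :: complex ^ 'n))"
  by (simp add: vec_eq_iff matrix_vector_mult_def scaleR_sum_right)

section \<open>Positive semidefinite operators\<close>

lemma psd_braket_nonneg: "psd A \<Longrightarrow> 0 \<le> Re (braket x (A *v x))"
  by (simp add: psd_def)

lemma hermitian_scaleR:
  assumes "hermitian A"
  shows "hermitian (c *\<^sub>R A)"
  unfolding hermitian_def
proof (intro allI)
  fix i j
  have "A $ i $ j = cnj (A $ j $ i)"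
    using assms unfolding hermitian_def by blast
  then show "(c *\<^sub>R A) $ i $ j = cnj ((c *\<^sub>R A) $ j $ i)"
    by simp
qed

lemma psd_scaleR: "psd A \<Longrightarrow> 0 \<le> c \<Longrightarrow> psd (c *\<^sub>R A)"
  by (simp add: psd_def hermitian_scaleR scaleR_matrix_vec_mult braket_scaleR_right)

lemma psd_ketbra: "psd (ketbra v v)"
proof -
  have "braket x (ketbra v v *v x) = complex_of_real ((cmod (braket v x))\<^sup>2)" for x
    unfolding ketbra_mult_vec braket_scale_right complex_norm_square cnj_braket by simp
  then show ?thesis
    by (simp add: psd_def hermitian_def ketbra_def mult.commute)
qed

text \<open>The complement \<open>ketbra w w\<close> carries the rest of the trace,
  \<open>braket w (A *v w)\<close>, which has nonnegative real part.\<close>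

lemma psd_trace_mult_ketbra_le:
  assumes "psd A" "ketbra v v + ketbra w w = mat 1"
  shows "Re (trace (A ** ketbra v v)) \<le> Re (trace A)"
proof -
  have "A = A ** ketbra v v + A ** ketbra w w"
    by (simp add: assms(2) flip: matrix_add_ldistrib)
  then have "trace A = trace (A ** ketbra v v) + trace (A ** ketbra w w)"
    by (metis trace_add)
  then show ?thesis
    using psd_braket_nonneg[OF assms(1), of w] by (simp add: trace_mult_ketbra)
qed

section \<open>Resolutions of the identity by the basis and by the trine\<close>

lemma orthonormal_basis2_completeness:
  assumes "orthonormal_basis2 e f"
  shows "ketbra e e + ketbra f f = mat 1"
proof -
  have "(ketbra e e + ketbra f f) *v x = x" for x
  proof -
    have "x \<in> vec.span {e, f}"
      using assms by (simp add: orthonormal_basis2_def)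
    then obtain a b where x: "x = a *s e + b *s f"
      by (auto simp: vec.span_insert vec.span_singleton algebra_simps)
    have "braket f e = 0"
      using assms cnj_braket[of e f] by (simp add: orthonormal_basis2_def)
    then show ?thesis
      using assms
      by (simp add: x orthonormal_basis2_def matrix_vector_mult_add_rdistrib ketbra_mult_vec
          braket_linear)
  qed
  then show ?thesis
    by (simp add: matrix_eq)
qed

text \<open>For orthonormal \<open>e\<close> and \<open>f\<close>, a unit vector orthogonal to
  \<open>trine_ket e f l\<close>; with it the second outcome becomes a \<open>ketbra\<close> as
  well.\<close>

definition trine_perp :: "complex ^ 'n \<Rightarrow> complex ^ 'n \<Rightarrow> 3 \<Rightarrow> complex ^ 'n" where
  "trine_perp e f l =
     (if l = 1 then f
      else if l = 2 then (1 / 2 :: complex) *s (complex_of_real (sqrt 3) *s e - f)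
      else (1 / 2 :: complex) *s (complex_of_real (sqrt 3) *s e + f))"

lemma complex_sqrt_3_square: "complex_of_real (sqrt 3) * complex_of_real (sqrt 3) = 3"
  by (simp flip: of_real_mult)

lemma complex_sqrt_3_square_left:
  "complex_of_real (sqrt 3) * (complex_of_real (sqrt 3) * z) = 3 * z"
  by (simp add: complex_sqrt_3_square flip: mult.assoc)

text \<open>A real orthogonal matrix takes \<open>e\<close>, \<open>f\<close> to the two vectors on
  the left, and such a change preserves the sum of the two ketbras.\<close>

lemma trine_ket_perp_completeness:
  "ketbra (trine_ket e f l) (trine_ket e f l) + ketbra (trine_perp e f l) (trine_perp e f l)
     = ketbra e e + ketbra f f"
  by (simp add: vec_eq_iff ketbra_def trine_ket_def trine_perp_def complex_sqrt_3_square
      complex_sqrt_3_square_left algebra_simps add_divide_distrib diff_divide_distrib)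

text \<open>The cross terms of the second and third vectors cancel; the diagonal weights are 1 + 1/4
  + 1/4 and 3/4 + 3/4.\<close>

lemma sum_trine_ketbra:
  "(\<Sum>l\<in>UNIV. ketbra (trine_ket e f l) (trine_ket e f l))
     = (3 / 2 :: real) *\<^sub>R (ketbra e e + ketbra f f)"
  unfolding sum_3 vec_eq_iff vector_scaleR_component
  by (simp add: ketbra_def trine_ket_def complex_sqrt_3_square complex_sqrt_3_square_left
      algebra_simps add_divide_distrib diff_divide_distrib scaleR_conv_of_real)

section \<open>Inequalities for the bound on simple tests\<close>

text \<open>On real combinations of \<open>e\<close> and \<open>f\<close>, \<open>A\<close> induces
  a nonnegative binary quadratic form, whose discriminant cannot be positive.\<close>

lemma psd_cross_term_bound:
  assumes "psd A"
  shows "(Re (braket e (A *v f) + braket f (A *v e)))\<^sup>2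
         \<le> 4 * Re (braket e (A *v e)) * Re (braket f (A *v f))"
proof -
  define \<alpha> \<beta> \<gamma> where "\<alpha> = Re (braket e (A *v e))" and "\<beta> = Re (braket f (A *v f))"
    and "\<gamma> = Re (braket e (A *v f) + braket f (A *v e)) / 2"
  have form: "0 \<le> a\<^sup>2 * \<alpha> + 2 * a * b * \<gamma> + b\<^sup>2 * \<beta>" for a b :: real
  proof -
    have "Re (braket (complex_of_real a *s e + complex_of_real b *s f)
            (A *v (complex_of_real a *s e + complex_of_real b *s f)))
        = a\<^sup>2 * \<alpha> + 2 * a * b * \<gamma> + b\<^sup>2 * \<beta>"
      by (simp add: \<alpha>_def \<beta>_def \<gamma>_def braket_linear matrix_vector_right_distrib
          vector_scalar_commute algebra_simps power2_eq_square)
    then show ?thesis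
      using psd_braket_nonneg[OF assms] by metis
  qed
  have nonneg: "0 \<le> \<alpha>" "0 \<le> \<beta>"
    using form[of 1 0] form[of 0 1] by simp_all
  have "\<gamma>\<^sup>2 \<le> \<alpha> * \<beta>"
  proof (cases "\<alpha> + \<beta> = 0")
    case True
    \<comment> \<open>Both \<alpha> and \<beta> vanish, so the form at (1, -\<gamma>) equals -2
      \<gamma>^2.\<close>
    then show ?thesis
      using nonneg form[of 1 "- \<gamma>"] by (simp add: power2_eq_square add_nonneg_eq_0_iff)
  next
    case False
    \<comment> \<open>Adding the form at (\<beta>, -\<gamma>) and at (-\<gamma>, \<alpha>) produces
      the common factor \<alpha> + \<beta>, so it does not matter which of the two is
      nonzero.\<close>
    have "\<gamma>\<^sup>2 * (\<alpha> + \<beta>) \<le> \<alpha> * \<beta> * (\<alpha> + \<beta>)"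
      using form[of \<beta> "- \<gamma>"] form[of "- \<gamma>" \<alpha>]
      by (simp add: power2_eq_square algebra_simps)
    then show ?thesis
      using False nonneg by (simp add: mult_le_cancel_right)
  qed
  then show ?thesis
    by (simp add: \<alpha>_def \<beta>_def \<gamma>_def power_divide)
qed

text \<open>The difference of the two averages is the average of \<open>t i - t j\<close> under the
  product weights \<open>q i * r j\<close>.\<close>

lemma sum_weighted_diff_le:
  fixes t q r :: "'a \<Rightarrow> real"
  assumes "\<And>i. i \<in> I \<Longrightarrow> 0 \<le> q i" "\<And>i. i \<in> I \<Longrightarrow> 0 \<le> r i" "sum q I = 1" "sum r I = 1"
    and le: "\<And>i j. i \<in> I \<Longrightarrow> j \<in> I \<Longrightarrow> t i - t j \<le> D"
  shows "(\<Sum>i\<in>I. q i * t i) - (\<Sum>i\<in>I. r i * t i) \<le> D"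
proof -
  have "(\<Sum>i\<in>I. q i * t i) - (\<Sum>j\<in>I. r j * t j)
      = (\<Sum>i\<in>I. q i * t i) * sum r I - sum q I * (\<Sum>j\<in>I. r j * t j)"
    using assms by simp
  also have "\<dots> = (\<Sum>i\<in>I. \<Sum>j\<in>I. q i * r j * (t i - t j))"
    unfolding sum_product sum_subtractf[symmetric] by (simp add: algebra_simps)
  also have "\<dots> \<le> (\<Sum>i\<in>I. \<Sum>j\<in>I. q i * r j * D)"
    by (intro sum_mono mult_left_mono le mult_nonneg_nonneg assms)
  also have "\<dots> = D"
    using assms by (simp flip: sum_distrib_left sum_distrib_right)
  finally show ?thesis .
qed

section \<open>Trine measurements relative to a fixed orthonormal basis\<close>

locale qubit_basis =
  fixes e f :: "complex ^ 'n"
  assumes basis: "orthonormal_basis2 e f"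
begin

lemma braket_basis: "braket e e = 1" "braket f f = 1" "braket e f = 0" "braket f e = 0"
  using basis cnj_braket[of e f] by (simp_all add: orthonormal_basis2_def)

lemma completeness: "ketbra e e + ketbra f f = mat 1"
  by (rule orthonormal_basis2_completeness[OF basis])

lemma trace_eq_braket_basis: "trace A = braket e (A *v e) + braket f (A *v f)"
proof -
  have "trace A = trace (A ** ketbra e e + A ** ketbra f f)"
    by (simp add: completeness flip: matrix_add_ldistrib)
  then show ?thesis
    by (simp add: trace_add trace_mult_ketbra)
qed

lemma trine_completeness:
  "ketbra (trine_ket e f l) (trine_ket e f l) + ketbra (trine_perp e f l) (trine_perp e f l)
     = mat 1"
  by (simp add: trine_ket_perp_completeness completeness)

lemma trine_meas_eq_ketbra:
  "trine_meas e f l j =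
     (if j = 1 then ketbra (trine_ket e f l) (trine_ket e f l)
      else ketbra (trine_perp e f l) (trine_perp e f l))"
  by (simp add: trine_meas_def Let_def diff_eq_eq add.commute flip: trine_completeness[of l])

lemma psd_trine_meas: "psd (trine_meas e f l j)"
  by (simp add: trine_meas_eq_ketbra psd_ketbra)

lemma trace_mult_trine_meas_le:
  assumes "psd A"
  shows "Re (trace (A ** trine_meas e f l j)) \<le> Re (trace A)"
  using psd_trace_mult_ketbra_le[OF assms trine_completeness[of l]]
    psd_trace_mult_ketbra_le[OF assms trans[OF add.commute trine_completeness[of l]]]
  by (simp add: trine_meas_eq_ketbra)

lemma braket_trine_ket_self: "braket (trine_ket e f l) (trine_ket e f l) = 1"
  by (simp add: trine_ket_def braket_linear braket_basis complex_sqrt_3_square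
      complex_sqrt_3_square_left)

lemma braket_trine_perp_self: "braket (trine_perp e f l) (trine_perp e f l) = 1"
  by (simp add: trine_perp_def braket_linear braket_basis complex_sqrt_3_square
      complex_sqrt_3_square_left)

lemma trace_trine_meas_square: "trace (trine_meas e f l j ** trine_meas e f l j) = 1"
  by (simp add: trine_meas_eq_ketbra trace_mult_ketbra ketbra_mult_vec braket_scale_right
      braket_trine_ket_self braket_trine_perp_self)

lemma sum_trine_meas: "(\<Sum>l\<in>UNIV. trine_meas e f l j) = (3 / 2 :: real) *\<^sub>R mat 1"
proof -
  \<comment> \<open>For the second outcome, three identities minus 3/2 of the identity again leave
    3/2.\<close>
  have "(\<Sum>l\<in>UNIV. mat 1 - ketbra (trine_ket e f l) (trine_ket e f l)) = (3 / 2 :: real) *\<^sub>R mat 1"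
    unfolding sum_subtractf sum_trine_ketbra completeness
      vec_eq_iff vector_minus_component vector_scaleR_component
    by (simp add: mat_def scaleR_conv_of_real)
  then show ?thesis
    by (cases "j = 1") (simp_all add: trine_meas_def Let_def sum_trine_ketbra completeness)
qed

lemma trine_difference_le:
  assumes "density \<rho>"
  shows "Re (trace (\<rho> ** trine_meas e f l 1)) - Re (trace (\<rho> ** trine_meas e f m 1))
         \<le> sqrt 3 / 2"
proof -
  \<comment> \<open>\<open>x\<close> and \<open>y\<close> are the Bloch coordinates of \<open>\<rho>\<close> in the plane of the trine.\<close>
  define x y where "x = Re (braket e (\<rho> *v e)) - Re (braket f (\<rho> *v f))"
    and "y = Re (braket e (\<rho> *v f) + braket f (\<rho> *v e))"
  have tr: "Re (braket e (\<rho> *v e)) + Re (braket f (\<rho> *v f)) = 1"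
    using assms trace_eq_braket_basis[of \<rho>]
    by (metis density_def one_complex.sel(1) plus_complex.sel(1))
  have "psd \<rho>"
    using assms by (simp add: density_def)
  have "y\<^sup>2 \<le> 4 * Re (braket e (\<rho> *v e)) * Re (braket f (\<rho> *v f))"
    using psd_cross_term_bound[OF \<open>psd \<rho>\<close>, of e f] by (simp add: y_def)
  also have "\<dots> = 1 - x\<^sup>2"
    unfolding x_def using tr by algebra
  finally have disc: "x\<^sup>2 + y\<^sup>2 \<le> 1"
    by simp
  \<comment> \<open>Cauchy-Schwarz, by expanding the squared distance of (x, y) from the unit vector
    (c, s).\<close>
  have dot: "c * x + s * y \<le> 1" if "c\<^sup>2 + s\<^sup>2 = 1" for c s :: real
    using disc that sum_power2_ge_zero[of "c - x" "s - y"]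
    by (simp add: power2_eq_square algebra_simps)
  \<comment> \<open>Absorbing \<open>sqrt 3\<close> into \<open>z\<close> makes the closing case
    analysis linear.\<close>
  define z where "z = sqrt 3 * y"
  \<comment> \<open>The trine has Bloch vectors (1, 0) and (-1/2, +-sqrt 3 / 2).\<close>
  have t: "Re (trace (\<rho> ** trine_meas e f l 1)) =
    (if l = 1 then (1 + x) / 2 else if l = 2 then (2 - x + z) / 4 else (2 - x - z) / 4)" for l
    using tr
    by (simp add: x_def y_def z_def trine_meas_def Let_def trine_ket_def trace_mult_ketbra braket_linear
        matrix_vector_right_distrib matrix_vector_mult_diff_distrib vector_scalar_commute
        complex_sqrt_3_square_left field_simps)
  \<comment> \<open>These bounds settle the pair of trine vectors 2 and 3.\<close>
  have z: "z \<le> sqrt 3" "- z \<le> sqrt 3"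
    using dot[of 0 1] dot[of 0 "-1"] mult_left_le[of y "sqrt 3"] mult_left_le[of "- y" "sqrt 3"]
    by (simp_all add: z_def)
  \<comment> \<open>For the pairs containing vector 1: their Bloch differences are
    \<open>sqrt 3\<close> times the unit vectors (a sqrt 3 / 2, b / 2).\<close>
  have xz: "3 * (a * x) + b * z \<le> 2 * sqrt 3" if "a \<in> {1, -1}" "b \<in> {1, -1}" for a b
  proof -
    have "(a * sqrt 3 / 2) * x + (b / 2) * y \<le> 1"
      using that by (intro dot) (auto simp: power_divide)
    then have "2 * sqrt 3 * ((a * sqrt 3 / 2) * x + (b / 2) * y) \<le> 2 * sqrt 3"
      by (simp add: mult_left_le)
    also have "2 * sqrt 3 * ((a * sqrt 3 / 2) * x + (b / 2) * y)
        = (sqrt 3 * sqrt 3) * (a * x) + b * z"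
      by (simp add: z_def algebra_simps del: real_sqrt_mult_self)
    finally show ?thesis
      by simp
  qed
  show ?thesis
    using exhaust_3[of l] exhaust_3[of m] z xz[of 1 1] xz[of 1 "-1"] xz[of "-1" 1] xz[of "-1" "-1"]
    by (elim disjE) (simp_all add: t field_simps)
qed

section \<open>Maximum over general tests\<close>

lemma success_prob_general_le:
  assumes "general_test H"
  shows "success_prob (trine_meas e f) H \<le> 2 / 3"
proof -
  obtain \<rho> where psd: "\<And>l j. psd (H l j)" and \<rho>: "density \<rho>" "\<And>j. (\<Sum>l\<in>UNIV. H l j) = \<rho>"
    using assms by (auto simp: general_test_def)
  have "(\<Sum>l\<in>UNIV. \<Sum>j\<in>UNIV. Re (trace (H l j ** trine_meas e f l j)))
      \<le> (\<Sum>l\<in>UNIV. \<Sum>j\<in>UNIV. Re (trace (H l j)))"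
    by (intro sum_mono trace_mult_trine_meas_le psd)
  also have "\<dots> = (\<Sum>j\<in>UNIV. Re (trace (\<Sum>l\<in>UNIV. H l j)))"
    by (subst sum.swap) (simp add: trace_sum)
  also have "\<dots> = 2"
    using \<rho> by (simp add: density_def)
  finally show ?thesis
    by (simp add: success_prob_def)
qed

lemma success_prob_general_attained:
  "\<exists>H. general_test H \<and> success_prob (trine_meas e f) H = 2 / 3"
proof (intro exI conjI)
  let ?H = "\<lambda>l j. (1 / 3 :: real) *\<^sub>R trine_meas e f l j"
  have sum: "(\<Sum>l\<in>UNIV. ?H l j) = (1 / 2 :: real) *\<^sub>R mat 1" for j
    by (simp add: sum_trine_meas flip: scaleR_sum_right)
  have psd: "psd (?H l j)" for l j
    by (simp add: psd_scaleR psd_trine_meas)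
  have "trace (mat 1 :: complex ^ 'n ^ 'n) = 2"
    by (simp add: trace_eq_braket_basis braket_basis)
  moreover have "psd (mat 1 :: complex ^ 'n ^ 'n)"
    by (auto simp: psd_def hermitian_def mat_def) (simp add: braket_def sum_nonneg flip: mat_def)
  ultimately have "density ((1 / 2 :: real) *\<^sub>R mat 1 :: complex ^ 'n ^ 'n)"
    by (simp add: density_def trace_scaleR psd_scaleR)
  with psd sum show "general_test ?H"
    by (auto simp: general_test_def)
  \<comment> \<open>Each of the six traces is 1/3, since each outcome operator squares to trace
    1.\<close>
  show "success_prob (trine_meas e f) ?H = 2 / 3"
    by (simp add: success_prob_def scaleR_matrix_mult trace_scaleR trace_trine_meas_square)
qed

section \<open>Maximum over simple tests\<close>

lemma success_prob_simple_le:
  assumes "simple_test H"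
  shows "success_prob (trine_meas e f) H \<le> (2 + sqrt 3) / 6"
proof -
  obtain \<rho> q where \<rho>: "density \<rho>" and q: "postprocessing q" and H: "\<And>l j. H l j = q l j *\<^sub>R \<rho>"
    using assms by (auto simp: simple_test_def)
  define p where "p l = Re (trace (\<rho> ** trine_meas e f l 1))" for l
  have p2: "Re (trace (\<rho> ** trine_meas e f l 2)) = 1 - p l" for l
  proof -
    have "trine_meas e f l 2 = mat 1 - trine_meas e f l 1"
      by (simp add: trine_meas_def Let_def)
    then have "trace (\<rho> ** trine_meas e f l 2) + trace (\<rho> ** trine_meas e f l 1) = trace \<rho>"
      by (simp flip: trace_add matrix_add_ldistrib)
    then show ?thesis
      using \<rho> by (simp add: p_def density_def complex_eq_iff)
  qed
  \<comment> \<open>The weights are the distributions of the conclusion given outcome 1 and given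
    outcome 2.\<close>
  have "(\<Sum>l\<in>UNIV. q l 1 * p l) - (\<Sum>l\<in>UNIV. q l 2 * p l) \<le> sqrt 3 / 2"
    using q trine_difference_le[OF \<rho>]
    by (intro sum_weighted_diff_le) (auto simp: postprocessing_def p_def)
  moreover have "(\<Sum>l\<in>UNIV. \<Sum>j\<in>UNIV. Re (trace (H l j ** trine_meas e f l j)))
      = 1 + ((\<Sum>l\<in>UNIV. q l 1 * p l) - (\<Sum>l\<in>UNIV. q l 2 * p l))"
  proof -
    have "(\<Sum>l\<in>UNIV. q l 2 * (1 - p l)) = 1 - (\<Sum>l\<in>UNIV. q l 2 * p l)"
      using q by (simp add: postprocessing_def right_diff_distrib sum_subtractf)
    then show ?thesis
      by (simp add: H scaleR_matrix_mult trace_scaleR sum_2 p2 sum.distrib flip: p_def)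
  qed
  ultimately show ?thesis
    by (simp add: success_prob_def)
qed

lemma success_prob_simple_attained:
  "\<exists>H. simple_test H \<and> success_prob (trine_meas e f) H = (2 + sqrt 3) / 6"
proof (intro exI conjI)
  \<comment> \<open>This probe has Bloch vector (0, 1), parallel to the difference of trine vectors
    2 and 3; conclusion 1 is never drawn.\<close>
  define \<rho> where "\<rho> = (1 / 2 :: real) *\<^sub>R ketbra (e + f) (e + f)"
  define q :: "3 \<Rightarrow> 2 \<Rightarrow> real"
    where "q l j = (if l = (if j = 1 then 2 else 3) then 1 else 0)" for l j
  have "density \<rho>"
    by (simp add: \<rho>_def density_def psd_scaleR psd_ketbra trace_scaleR trace_ketbra braket_linear
        braket_basis)
  moreover have "postprocessing q"
    by (simp add: postprocessing_def q_def)
  ultimately show "simple_test (\<lambda>l j. q l j *\<^sub>R \<rho>)"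
    by (auto simp: simple_test_def)
  show "success_prob (trine_meas e f) (\<lambda>l j. q l j *\<^sub>R \<rho>) = (2 + sqrt 3) / 6"
    by (simp add: success_prob_def scaleR_matrix_mult trace_scaleR sum_2 sum_3 q_def \<rho>_def
        trine_meas_eq_ketbra trace_mult_ketbra ketbra_mult_vec scaleR_matrix_vec_mult
        braket_scaleR_right braket_linear braket_basis trine_ket_def trine_perp_def field_simps)
qed

end

theorem mainTheorem8:
  fixes ket0 ket1 :: "complex ^ 2"
  assumes "orthonormal_basis2 ket0 ket1"
  shows "is_maximum {success_prob (trine_meas ket0 ket1) H | H. general_test H} (2 / 3)
       \<and> is_maximum {success_prob (trine_meas ket0 ket1) H | H. simple_test H} ((2 + sqrt 3) / 6)
       \<and> (2 + sqrt 3) / 6 < (2 / 3 :: real)"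
proof -
  interpret qubit_basis ket0 ket1
    by unfold_locales (rule assms)
  have "sqrt 3 < (2 :: real)"
    by (rule real_less_lsqrt) simp_all
  then show ?thesis
    using success_prob_general_le success_prob_general_attained
      success_prob_simple_le success_prob_simple_attained
    unfolding is_maximum_def by (auto; metis)
qed

end
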